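(* Let $\nu$ be a divergent length distribution function with normalizing constant $Z_\nu$. If there exists $\varepsilon>0$ such that for all sufficiently large $L$ $$\frac{\int_0^L tZ_\nu(t)\,dt}{\int_0^L Z_\nu(t)\,dt}\ \ge\ (1+\varepsilon)\cdot\frac{L}{2},$$ then in the $\nu$-RSA process $\mathbb{E}[S_L]=o(L)$, i.e. $\lim_{L\to\infty}\mathbb{E}[S_L]/L=0$.
   Context: A length distribution function (ldf) is a nonnegative function $\nu:[0,\infty)\to[0,\infty)$, integrable on bounded intervals, with $\nu(\ell)=0$ for $\ell\in[0,1)$ and $\int_1^\ell\nu(t)\,dt>0$ for all $\ell>1$. Its normalizing constant is $Z_\nu(L)=\int_0^L\nu(\ell)\,d\ell$. It is convergent if $\lim_{L\to\infty}Z_\nu(L)<\infty$, and divergent otherwise. $\nu$-RSA process on $[0,L]$ ($L>1$): start with $I_0=[0,L]$. At each time $T=1,2,\dots$, independently of the past, sample $b$ uniformly from $[0,L]$ and, independently, a length $\ell\in[1,L]$ with density $\nu(\ell)/Z_\nu(L)$. If $(b,b+\ell)\subseteq I_{T-1}$, the segment is parked and $I_T=I_{T-1}\setminus(b,b+\ell)$; otherwise $I_T=I_{T-1}$. The empty space at saturation is $S_L=\lim_{T\to\infty}\lambda(I_T)$, where $\lambda$ is Lebesgue measure. For $0\le L\le 1$ no segment is parked and $S_L=L$. *)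

theory Defs
  imports "HOL-Probability.Probability"
begin

text \<open>
  A length distribution function lives on \<open>[0,\<infinity>)\<close>; as a total function on the reals, its values at
  negative arguments are unconstrained and never used. Integrability is Lebesgue integrability,
  so \<open>\<nu>\<close> is only required to be Lebesgue measurable, not Borel.
\<close>

definition ldf :: "(real \<Rightarrow> real) \<Rightarrow> bool" where
  "ldf \<nu> \<longleftrightarrow>
     (\<forall>t\<ge>0. 0 \<le> \<nu> t) \<and>
     (\<forall>a b. 0 \<le> a \<longrightarrow> set_integrable lebesgue {a..b} \<nu>) \<and>
     (\<forall>t. 0 \<le> t \<and> t < 1 \<longrightarrow> \<nu> t = 0) \<and>
     (\<forall>l>1. 0 < (LINT t:{1..l}|lebesgue. \<nu> t))"

definition Z :: "(real \<Rightarrow> real) \<Rightarrow> real \<Rightarrow> real" where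
  "Z \<nu> L = (LINT t:{0..L}|lebesgue. \<nu> t)"

definition convergent_ldf :: "(real \<Rightarrow> real) \<Rightarrow> bool" where
  "convergent_ldf \<nu> \<longleftrightarrow> ldf \<nu> \<and> (\<exists>z::real. (Z \<nu> \<longlongrightarrow> z) at_top)"

definition divergent_ldf :: "(real \<Rightarrow> real) \<Rightarrow> bool" where
  "divergent_ldf \<nu> \<longleftrightarrow> ldf \<nu> \<and> \<not> convergent_ldf \<nu>"

text \<open>
  The law on \<open>[1,L]\<close> with density \<open>\<nu>(\<ell>)/Z\<^sub>\<nu>(L)\<close>. As \<open>\<nu>\<close> is only Lebesgue measurable, the density is
  taken with respect to \<^const>\<open>lebesgue\<close> and the resulting measure is restricted to the Borel sets
  (the push-forward under the identity).
\<close>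

definition length_law :: "(real \<Rightarrow> real) \<Rightarrow> real \<Rightarrow> real measure" where
  "length_law \<nu> L =
     distr (density lebesgue (\<lambda>l. ennreal (indicator {1..L} l * (\<nu> l / Z \<nu> L)))) borel (\<lambda>l. l)"

text \<open>
  The probability space of the process for \<open>L > 1\<close>: i.i.d. pairs \<open>(b, \<ell>)\<close> with independent components,
  the pair at index \<open>T\<close> being the one sampled at time \<open>T + 1\<close>.
\<close>

definition RSA_space :: "(real \<Rightarrow> real) \<Rightarrow> real \<Rightarrow> (nat \<Rightarrow> real \<times> real) measure" where
  "RSA_space \<nu> L =
     (\<Pi>\<^sub>M T\<in>(UNIV::nat set). uniform_measure lborel {0..L} \<Otimes>\<^sub>M length_law \<nu> L)"

primrec RSA_free :: "real \<Rightarrow> (nat \<Rightarrow> real \<times> real) \<Rightarrow> nat \<Rightarrow> real set" where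
  "RSA_free L \<omega> 0 = {0..L}"
| "RSA_free L \<omega> (Suc T) =
     (let b = fst (\<omega> T); l = snd (\<omega> T); I = RSA_free L \<omega> T
      in if {b<..<b + l} \<subseteq> I then I - {b<..<b + l} else I)"

definition RSA_empty_space :: "real \<Rightarrow> (nat \<Rightarrow> real \<times> real) \<Rightarrow> real" where
  "RSA_empty_space L \<omega> = lim (\<lambda>T. measure lborel (RSA_free L \<omega> T))"

text \<open>
  \<open>E[S\<^sub>L]\<close>. For \<open>L \<le> 1\<close> no segment is parked and \<open>S\<^sub>L = L\<close> is deterministic; \<^const>\<open>RSA_space\<close> is then
  not a probability space, as \<open>Z\<^sub>\<nu>(L) = 0\<close>.
\<close>

definition expected_empty_space :: "(real \<Rightarrow> real) \<Rightarrow> real \<Rightarrow> real" where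
  "expected_empty_space \<nu> L =
     (if L \<le> 1 then L else \<integral>\<omega>. RSA_empty_space L \<omega> \<partial>RSA_space \<nu> L)"

end

theory Submission imports Defs begin

text \<open>
  Parking a segment of length \<open>\<ell>\<close> in a gap of length \<open>g\<close> leaves gaps \<open>u\<close>, \<open>v\<close> with \<open>u + v = g - \<ell>\<close>, and the
  segment fits with probability proportional to \<open>g - \<ell>\<close>. In terms of
  \<open>J\<^sub>k(g) = \<integral>\<^sub>0\<^sup>g (g - \<ell>)\<^sup>k \<nu>(\<ell>) d\<ell>\<close> the hypothesis reads \<open>J\<^sub>2(g) \<le> (1 - \<epsilon>) g J\<^sub>1(g)\<close> for \<open>g \<ge> M\<close>.
  Shrink \<open>\<epsilon>\<close> below 1, put \<open>q = (1 - \<epsilon>) / 2\<close>, choose \<open>\<alpha> < 1\<close> with \<open>2 q\<^sup>\<alpha> = 1\<close>, and let \<open>\<phi>(t) = t\<close> for \<open>t \<le> M\<close> and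
  \<open>\<phi>(t) = M (t / M)\<^sup>\<alpha>\<close> for \<open>t > M\<close>. The tangent to \<open>t\<^sup>\<alpha>\<close> at \<open>q g\<close> shows that splitting a gap does not
  increase the sum of \<open>\<phi>\<close> over the gaps in expectation, so this sum stays at most \<open>\<phi>(L) = o(L)\<close>.
  A gap longer than \<open>M\<close> loses length at least 1 with probability bounded below at each time, so gaps with
  \<open>\<phi>(t) < t\<close> disappear in the long run and the empty space is eventually counted by \<open>\<phi>\<close>. Both
  effects are tracked by one induction on the number of steps, bounding the expected empty space summed over
  the times \<open>T < N\<close> by \<open>N \<phi>(L) + O(1)\<close> for fixed \<open>L\<close>; dividing by \<open>N\<close> bounds \<open>E[S\<^sub>L]\<close>.
\<close>

section \<open>Gaps of the process\<close>

definition RSA_step :: "real set \<Rightarrow> real \<times> real \<Rightarrow> real set" where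
  "RSA_step I s =
     (if {fst s<..<fst s + snd s} \<subseteq> I then I - {fst s<..<fst s + snd s} else I)"

text \<open>Consumes the first sample and recurses on the shifted sequence, whereas
  \<open>RSA_free\<close> applies the last sample at the end; this exposes the gaps left by the
  first segment.\<close>

primrec RSA_from :: "real set \<Rightarrow> nat \<Rightarrow> (nat \<Rightarrow> real \<times> real) \<Rightarrow> real set" where
  "RSA_from I 0 \<omega> = I"
| "RSA_from I (Suc T) \<omega> = RSA_from (RSA_step I (\<omega> 0)) T (\<lambda>i. \<omega> (Suc i))"

lemma RSA_from_Suc: "RSA_from I (Suc T) \<omega> = RSA_step (RSA_from I T \<omega>) (\<omega> T)"
proof (induction T arbitrary: I \<omega>)
  case (Suc T)
  show ?case
    using Suc.IH[of "RSA_step I (\<omega> 0)" "\<lambda>i. \<omega> (Suc i)"] by simp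
qed simp

lemma RSA_free_eq_RSA_from: "RSA_free L \<omega> T = RSA_from {0..L} T \<omega>"
  by (induction T) (simp_all add: RSA_from_Suc RSA_step_def Let_def del: RSA_from.simps(2))

lemma RSA_step_subset: "RSA_step I s \<subseteq> I"
  by (auto simp: RSA_step_def)

lemma RSA_step_Un:
  assumes "I \<subseteq> {..c}" "J \<subseteq> {d..}" "c < d"
  shows "RSA_step (I \<union> J) s = RSA_step I s \<union> RSA_step J s"
proof -
  define K where "K = {fst s<..<fst s + snd s}"
  show ?thesis
  proof (cases "K = {}")
    case True
    then show ?thesis by (simp add: RSA_step_def K_def)
  next
    case False
    have "K \<subseteq> I \<or> K \<subseteq> J" if "K \<subseteq> I \<union> J"
    proof (rule ccontr)
      assume "\<not> (K \<subseteq> I \<or> K \<subseteq> J)"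
      then obtain x y where xy: "x \<in> K" "x \<notin> J" "y \<in> K" "y \<notin> I"
        by blast
      then have "x \<le> c" "d \<le> y"
        using that assms(1,2) by (auto simp: subset_iff)
      \<comment> \<open>An interval meeting both sides contains the midpoint of the separating gap,
        which lies in neither set.\<close>
      then have "(c + d) / 2 \<in> K"
        using xy(1,3) assms(3) by (simp add: K_def)
      then have "(c + d) / 2 \<le> c \<or> d \<le> (c + d) / 2"
        using that assms(1,2) by (meson UnE atLeast_iff atMost_iff subset_iff)
      then show False using assms(3) by auto
    qed
    moreover have "I \<inter> J = {}" using assms by fastforce
    ultimately show ?thesis
      using False unfolding RSA_step_def K_def[symmetric] by (auto split: if_splits)
  qed
qed

lemma RSA_from_Un:
  assumes "I \<subseteq> {..c}" "J \<subseteq> {d..}" "c < d"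
  shows "RSA_from (I \<union> J) T \<omega> = RSA_from I T \<omega> \<union> RSA_from J T \<omega>"
  using assms
proof (induction T arbitrary: I J \<omega>)
  case (Suc T)
  have "RSA_step I (\<omega> 0) \<subseteq> {..c}" "RSA_step J (\<omega> 0) \<subseteq> {d..}"
    using Suc.prems RSA_step_subset by blast+
  then show ?case
    using Suc.IH[of "RSA_step I (\<omega> 0)" "RSA_step J (\<omega> 0)"] Suc.prems
    by (simp add: RSA_step_Un)
qed simp

lemma RSA_from_subset: "RSA_from I T \<omega> \<subseteq> I"
  by (induction T arbitrary: I \<omega>) (use RSA_step_subset in fastforce)+

lemma borel_RSA_step: "I \<in> sets borel \<Longrightarrow> RSA_step I s \<in> sets borel"
  by (simp add: RSA_step_def)

lemma borel_RSA_from: "I \<in> sets borel \<Longrightarrow> RSA_from I T \<omega> \<in> sets borel"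
  by (induction T arbitrary: I \<omega>) (simp_all add: borel_RSA_step)

lemma emeasure_RSA_from_Icc: "emeasure lborel (RSA_from {a..b} T \<omega>) < \<infinity>"
proof -
  have "emeasure lborel (RSA_from {a..b} T \<omega>) \<le> emeasure lborel {a..b}"
    by (intro emeasure_mono RSA_from_subset) simp
  also have "\<dots> < \<infinity>"
    by (simp add: emeasure_lborel_Icc_eq)
  finally show ?thesis .
qed

text \<open>A segment of nonpositive length counts as not fitting: it removes nothing, and positive
  length keeps the two remaining gaps strictly apart, as \<open>RSA_from_Un\<close>
  requires.\<close>

definition RSA_fits :: "real \<Rightarrow> real \<Rightarrow> real \<times> real \<Rightarrow> bool" where
  "RSA_fits a b s \<longleftrightarrow> 0 < snd s \<and> a \<le> fst s \<and> fst s + snd s \<le> b"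

text \<open>
  The empty space of the process started from \<open>[a, b]\<close>, summed over the times \<open>T < N\<close>. Recursing on the first
  sample makes the two gaps created by it evolve separately, driven by the same later samples.
\<close>

primrec RSA_total :: "nat \<Rightarrow> real \<Rightarrow> real \<Rightarrow> (nat \<Rightarrow> real \<times> real) \<Rightarrow> real" where
  "RSA_total 0 a b \<omega> = 0"
| "RSA_total (Suc N) a b \<omega> = (b - a) +
     (if RSA_fits a b (\<omega> 0)
      then RSA_total N a (fst (\<omega> 0)) (\<lambda>i. \<omega> (Suc i)) +
           RSA_total N (fst (\<omega> 0) + snd (\<omega> 0)) b (\<lambda>i. \<omega> (Suc i))
      else RSA_total N a b (\<lambda>i. \<omega> (Suc i)))"

lemma RSA_step_Icc:
  assumes "a \<le> b"
  shows "RSA_step {a..b} s =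
    (if RSA_fits a b s then {a..fst s} \<union> {fst s + snd s..b} else {a..b})"
proof (cases "0 < snd s")
  case True
  have "{fst s<..<fst s + snd s} \<subseteq> {a..b} \<longleftrightarrow> RSA_fits a b s"
    using True by (simp add: RSA_fits_def greaterThanLessThan_subseteq_atLeastAtMost_iff)
  then show ?thesis
    using True by (auto simp: RSA_step_def RSA_fits_def)
qed (auto simp: RSA_step_def RSA_fits_def)

lemma RSA_total_eq_sum:
  assumes "a \<le> b"
  shows "RSA_total N a b \<omega> = (\<Sum>T<N. measure lborel (RSA_from {a..b} T \<omega>))"
  using assms
proof (induction N arbitrary: a b \<omega>)
  case (Suc N)
  define s where "s = \<omega> 0"
  define \<omega>' where "\<omega>' = (\<lambda>i. \<omega> (Suc i))"
  have "(\<Sum>T<N. measure lborel (RSA_from (RSA_step {a..b} s) T \<omega>')) =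
    (if RSA_fits a b s then RSA_total N a (fst s) \<omega>' + RSA_total N (fst s + snd s) b \<omega>'
     else RSA_total N a b \<omega>')"
  proof (cases "RSA_fits a b s")
    case True
    have "measure lborel (RSA_from ({a..fst s} \<union> {fst s + snd s..b}) T \<omega>') =
      measure lborel (RSA_from {a..fst s} T \<omega>') + measure lborel (RSA_from {fst s + snd s..b} T \<omega>')" for T
    proof -
      have "RSA_from {a..fst s} T \<omega>' \<inter> RSA_from {fst s + snd s..b} T \<omega>' = {}"
        using RSA_from_subset[of "{a..fst s}" T \<omega>'] RSA_from_subset[of "{fst s + snd s..b}" T \<omega>'] True
        by (fastforce simp: RSA_fits_def)
      then show ?thesis
        using True emeasure_RSA_from_Icc[THEN less_imp_neq]
        by (subst RSA_from_Un[of _ "fst s" _ "fst s + snd s"])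
           (auto simp: RSA_fits_def borel_RSA_from intro!: measure_Union)
    qed
    then show ?thesis
      using True Suc by (simp add: RSA_step_Icc sum.distrib Suc.IH RSA_fits_def)
  qed (use Suc in \<open>simp add: RSA_step_Icc\<close>)
  then show ?case
    using Suc.prems by (simp add: sum.lessThan_Suc_shift s_def \<omega>'_def del: sum.lessThan_Suc)
qed simp

lemma RSA_total_nonneg: "a \<le> b \<Longrightarrow> 0 \<le> RSA_total N a b \<omega>"
  by (simp add: RSA_total_eq_sum sum_nonneg)

text \<open>The free measure decreases in time, so its limit lies below each of the \<open>N\<close>
  summands.\<close>

lemma RSA_empty_space_le_total:
  assumes "0 \<le> L"
  shows "0 \<le> RSA_empty_space L \<omega>" "real N * RSA_empty_space L \<omega> \<le> RSA_total N 0 L \<omega>"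
proof -
  define m where "m T = measure lborel (RSA_free L \<omega> T)" for T
  have dec: "decseq m"
    unfolding m_def RSA_free_eq_RSA_from
    by (intro decseq_SucI measure_mono_fmeasurable)
       (use emeasure_RSA_from_Icc[of 0 L] in \<open>simp_all add: fmeasurable_def RSA_from_Suc
          borel_RSA_from borel_RSA_step RSA_step_subset del: RSA_from.simps(2)\<close>)
  obtain x where x: "m \<longlonglongrightarrow> x"
    using decseq_convergent[OF dec, of 0] by (auto simp: m_def)
  then have lim: "RSA_empty_space L \<omega> = x"
    unfolding RSA_empty_space_def m_def by (rule limI)
  show "0 \<le> RSA_empty_space L \<omega>"
    unfolding lim using x by (rule LIMSEQ_le_const) (simp add: m_def)
  have "(\<Sum>T<N. x) \<le> (\<Sum>T<N. m T)"
    using decseq_ge[OF dec x] by (intro sum_mono)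
  then show "real N * RSA_empty_space L \<omega> \<le> RSA_total N 0 L \<omega>"
    using assms by (simp add: lim RSA_total_eq_sum m_def RSA_free_eq_RSA_from)
qed

section \<open>The length law\<close>

locale RSA =
  fixes \<nu> :: "real \<Rightarrow> real" and L :: real
  assumes ldf: "ldf \<nu>" and L: "1 < L"
begin

abbreviation U :: "real measure" where "U \<equiv> uniform_measure lborel {0..L}"

abbreviation \<Lambda> :: "real measure" where "\<Lambda> \<equiv> length_law \<nu> L"

text \<open>For \<open>k >= 1\<close> and \<open>g <= L\<close> this is
  \<open>J\<^sub>k(g) / Z \<nu> L\<close>.\<close>

definition moment :: "nat \<Rightarrow> real \<Rightarrow> real" where
  "moment k g = (\<integral>l. (max 0 (g - l)) ^ k \<partial>\<Lambda>)"

lemma integrable_window: "integrable lebesgue (\<lambda>l. indicator {0..t} l * \<nu> l)"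
  using ldf by (auto simp: ldf_def set_integrable_def)

lemma \<nu>_nonneg: "0 \<le> l \<Longrightarrow> 0 \<le> \<nu> l"
  using ldf by (auto simp: ldf_def)

lemma window_eq: "indicator {1..t} l * \<nu> l = indicator {0..t} l * \<nu> l"
  using ldf by (auto simp: ldf_def split: split_indicator)

lemma Z_eq: "Z \<nu> t = (\<integral>l. indicator {0..t} l * \<nu> l \<partial>lebesgue)"
  by (simp add: Z_def set_lebesgue_integral_def)

lemma Z_pos: "1 < t \<Longrightarrow> 0 < Z \<nu> t"
  using ldf by (auto simp: ldf_def Z_eq set_lebesgue_integral_def simp flip: window_eq)

text \<open>The window may start at 0 because \<nu> vanishes on [0,1); the normalization is then the
  definition of \<open>Z\<close>.\<close>

definition dens :: "real \<Rightarrow> real" where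
  "dens l = indicator {0..L} l * \<nu> l / Z \<nu> L"

lemma dens_nonneg: "0 \<le> dens l"
  using Z_pos[OF L] by (auto simp: dens_def \<nu>_nonneg split: split_indicator)

lemma integrable_dens: "integrable lebesgue dens"
  unfolding dens_def using integrable_window by (rule integrable_divide)

lemma measurable_dens [measurable]: "dens \<in> borel_measurable lebesgue"
  using integrable_dens by (rule borel_measurable_integrable)

lemma measurable_id_lebesgue: "(\<lambda>l. l) \<in> lebesgue \<rightarrow>\<^sub>M (borel :: real measure)"
  by (rule measurable_completion) simp

lemma length_law_eq: "\<Lambda> = distr (density lebesgue (\<lambda>l. ennreal (dens l))) borel (\<lambda>l. l)"
proof -
  have "indicator {1..L} l * (\<nu> l / Z \<nu> L) = dens l" for l
    using window_eq[of L l] by (simp add: dens_def)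
  then show ?thesis by (simp add: length_law_def)
qed

lemma sets_length_law [simp, measurable_cong]: "sets \<Lambda> = sets borel"
  by (simp add: length_law_eq)

lemma space_length_law [simp]: "space \<Lambda> = UNIV"
  by (simp add: length_law_eq)

lemma integral_length_law:
  assumes [measurable]: "f \<in> borel_measurable borel"
  shows "(\<integral>l. f l \<partial>\<Lambda>) = (\<integral>l. dens l * f l \<partial>lebesgue)"
proof -
  have [measurable]: "f \<in> borel_measurable lebesgue"
    by (rule measurable_completion) simp
  show ?thesis
    unfolding length_law_eq
    by (simp add: integral_distr integral_density dens_nonneg measurable_id_lebesgue)
qed

lemma prob_space_length_law: "prob_space \<Lambda>"
proof
  have "emeasure \<Lambda> (space \<Lambda>) = (\<integral>\<^sup>+l. dens l \<partial>lebesgue)"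
    by (simp add: length_law_eq emeasure_distr emeasure_density measurable_id_lebesgue)
  also have "\<dots> = ennreal (\<integral>l. dens l \<partial>lebesgue)"
    by (intro nn_integral_eq_integral integrable_dens) (simp add: dens_nonneg)
  also have "(\<integral>l. dens l \<partial>lebesgue) = 1"
    using Z_pos[OF L] by (simp add: dens_def flip: Z_eq)
  finally show "emeasure \<Lambda> (space \<Lambda>) = 1" by simp
qed

lemma prob_space_U: "prob_space U"
  using L by (intro prob_space_uniform_measure) auto

sublocale Law: prob_space \<Lambda> by (rule prob_space_length_law)

sublocale Unif: prob_space U by (rule prob_space_U)

lemma AE_length_law: "AE l in \<Lambda>. 1 \<le> l \<and> l \<le> L"
proof -
  have "0 < dens l \<Longrightarrow> 1 \<le> l" "0 < dens l \<Longrightarrow> l \<le> L" for l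
    using window_eq[of L l] by (auto simp: dens_def split: split_indicator_asm)
  then show ?thesis
    unfolding length_law_eq by (subst AE_distr_iff) (auto simp: AE_density measurable_id_lebesgue intro!: AE_I2)
qed

lemma length_law_atMost:
  assumes "t \<le> L"
  shows "measure \<Lambda> {..t} = Z \<nu> t / Z \<nu> L"
proof -
  have "measure \<Lambda> {..t} = (\<integral>l. indicator {..t} l \<partial>\<Lambda>)"
    by simp
  also have "\<dots> = (\<integral>l. dens l * indicator {..t} l \<partial>lebesgue)"
    by (rule integral_length_law) simp
  also have "\<dots> = (\<integral>l. indicator {0..t} l * \<nu> l / Z \<nu> L \<partial>lebesgue)"
    using assms by (intro Bochner_Integration.integral_cong) (auto simp: dens_def split: split_indicator)
  finally show ?thesis by (simp add: Z_eq)
qed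

section \<open>Truncated moments and the integrals in the hypothesis\<close>

lemma integrable_moment: "integrable \<Lambda> (\<lambda>l. (max 0 (g - l)) ^ k)"
proof (rule Law.integrable_const_bound)
  show "AE l in \<Lambda>. norm ((max 0 (g - l)) ^ k) \<le> \<bar>g\<bar> ^ k"
    using AE_length_law by eventually_elim (auto intro!: power_mono)
qed measurable

text \<open>Up to the factor \<open>Z \<nu> L\<close>, \<open>Z\<close> is the distribution function
  of the length \<open>l\<close>, so Fubini turns the integral of \<open>t ^ k * P(l <= t)\<close>
  into the expected integral of \<open>t ^ k\<close> over [l, g].\<close>

lemma integral_power_Z:
  assumes "0 \<le> g" "g \<le> L"
  shows "(LINT t:{0..g}|lebesgue. t ^ k * Z \<nu> t) =
    Z \<nu> L * (\<integral>l. (if l \<le> g then (g ^ Suc k - l ^ Suc k) / Suc k else 0) \<partial>\<Lambda>)"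
proof -
  interpret P: pair_sigma_finite lborel \<Lambda> ..
  define f :: "real \<Rightarrow> real \<Rightarrow> real"
    where "f t l = indicator {0..g} t * t ^ k * indicator {..t} l" for t l
  have [measurable]: "case_prod f \<in> borel_measurable (lborel \<Otimes>\<^sub>M \<Lambda>)"
  proof -
    have "case_prod f = (\<lambda>p. if 0 \<le> fst p \<and> fst p \<le> g \<and> snd p \<le> fst p then fst p ^ k else 0)"
      by (auto simp: f_def fun_eq_iff split: split_indicator)
    then show ?thesis by simp
  qed
  have int: "integrable (lborel \<Otimes>\<^sub>M \<Lambda>) (case_prod f)"
  proof (rule integrableI_bounded_set[where A = "{0..g} \<times> UNIV" and B = "g ^ k"])
    have "emeasure (lborel \<Otimes>\<^sub>M \<Lambda>) ({0..g} \<times> UNIV) = emeasure lborel {0..g} * emeasure \<Lambda> UNIV"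
      by (rule Law.emeasure_pair_measure_Times) auto
    then show "emeasure (lborel \<Otimes>\<^sub>M \<Lambda>) ({0..g} \<times> UNIV) < \<infinity>"
      using Law.emeasure_space_1 assms(1) by simp
  qed (auto simp: f_def indicator_def intro!: AE_I2 power_mono)
  have "(LINT t:{0..g}|lebesgue. t ^ k * Z \<nu> t) =
      (\<integral>t. indicator {0..g} t * t ^ k * (Z \<nu> L * measure \<Lambda> {..t}) \<partial>lebesgue)"
    unfolding set_lebesgue_integral_def using assms Z_pos[OF L]
    by (intro Bochner_Integration.integral_cong) (auto simp: length_law_atMost split: split_indicator)
  also have "\<dots> = (\<integral>t. indicator {0..g} t * t ^ k * (Z \<nu> L * measure \<Lambda> {..t}) \<partial>lborel)"
  proof (rule integral_completion)
    \<comment> \<open>A distribution function is monotone, hence Borel, although \<nu> is only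
      Lebesgue measurable; this permits the passage to \<open>lborel\<close>.\<close>
    have "mono (\<lambda>t. measure \<Lambda> {..t})"
      by (intro monoI Law.finite_measure_mono) auto
    then have [measurable]: "(\<lambda>t. measure \<Lambda> {..t}) \<in> borel_measurable borel"
      by (rule borel_measurable_mono)
    show "(\<lambda>t. indicator {0..g} t * t ^ k * (Z \<nu> L * measure \<Lambda> {..t})) \<in> borel_measurable lborel"
      by measurable
  qed
  also have "\<dots> = Z \<nu> L * (\<integral>t. (\<integral>l. f t l \<partial>\<Lambda>) \<partial>lborel)"
    by (simp add: f_def mult_ac)
  also have "(\<integral>t. (\<integral>l. f t l \<partial>\<Lambda>) \<partial>lborel) = (\<integral>l. (\<integral>t. f t l \<partial>lborel) \<partial>\<Lambda>)"
    using P.Fubini_integral[OF int] by simp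
  also have "\<dots> = (\<integral>l. (if l \<le> g then (g ^ Suc k - l ^ Suc k) / Suc k else 0) \<partial>\<Lambda>)"
  proof (rule integral_cong_AE)
    show "AE l in \<Lambda>. (\<integral>t. f t l \<partial>lborel) = (if l \<le> g then (g ^ Suc k - l ^ Suc k) / Suc k else 0)"
      using AE_length_law
    proof eventually_elim
      case (elim l)
      have "f t l = t ^ k * indicator {l..g} t" for t
        using elim by (auto simp: f_def split: split_indicator)
      then show ?case
        using integral_power[of l g k] by auto
    qed
  qed measurable
  finally show ?thesis .
qed

lemma integral_Z:
  assumes "0 \<le> g" "g \<le> L"
  shows "(LINT t:{0..g}|lebesgue. Z \<nu> t) = Z \<nu> L * moment 1 g"
  using integral_power_Z[OF assms, of 0]
  by (auto simp: moment_def max_def intro!: arg_cong[where f = "integral\<^sup>L \<Lambda>"])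

lemma integral_id_Z:
  assumes "0 \<le> g" "g \<le> L"
  shows "(LINT t:{0..g}|lebesgue. t * Z \<nu> t) = Z \<nu> L * (g * moment 1 g - moment 2 g / 2)"
proof -
  \<comment> \<open>Rests on \<open>g^2 - l^2 = 2 * g * (g - l) - (g - l)^2\<close>.\<close>
  have "(\<lambda>l. if l \<le> g then (g ^ Suc 1 - l ^ Suc 1) / Suc 1 else 0) =
    (\<lambda>l. g * (max 0 (g - l)) ^ 1 - (max 0 (g - l)) ^ 2 / 2)"
    by (auto simp: fun_eq_iff max_def power2_eq_square field_simps)
  then have "(\<integral>l. (if l \<le> g then (g ^ Suc 1 - l ^ Suc 1) / Suc 1 else 0) \<partial>\<Lambda>) =
    (\<integral>l. g * (max 0 (g - l)) ^ 1 - (max 0 (g - l)) ^ 2 / 2 \<partial>\<Lambda>)"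
    by simp
  also have "\<dots> = g * moment 1 g - moment 2 g / 2"
    unfolding moment_def
    by (subst Bochner_Integration.integral_diff)
       (use integrable_moment[of g 1] integrable_moment[of g 2] in auto)
  finally show ?thesis
    using integral_power_Z[OF assms, of 1] by simp
qed

lemma moment_mono: "g \<le> h \<Longrightarrow> moment k g \<le> moment k h"
  unfolding moment_def by (intro integral_mono integrable_moment power_mono) auto

text \<open>Markov's inequality: lengths up to the midpoint \<open>t\<close> of 1 and
  \<open>g\<close> have positive probability, and each contributes at least
  \<open>g - t\<close>.\<close>

lemma moment_1_pos:
  assumes "1 < g" "g \<le> L"
  shows "0 < moment 1 g"
proof -
  define t where "t = (1 + g) / 2"
  have t: "1 < t" "t < g" using assms by (auto simp: t_def)
  have "0 < (g - t) * measure \<Lambda> {..t}"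
    using t assms Z_pos[of t] Z_pos[OF L] by (simp add: length_law_atMost)
  also have "\<dots> = (\<integral>l. (g - t) * indicator {..t} l \<partial>\<Lambda>)"
    by simp
  also have "\<dots> \<le> moment 1 g"
    unfolding moment_def
    using integrable_moment[of g 1] t
    by (intro integral_mono integrable_mult_right integrable_real_indicator)
       (auto simp: Law.emeasure_finite less_top[symmetric] split: split_indicator)
  finally show ?thesis .
qed

text \<open>The factor \<open>Z \<nu> L\<close> cancels, and the quotient of integrals equals
  \<open>g - moment 2 g / (2 * moment 1 g)\<close>.\<close>

lemma moment_2_le:
  assumes "1 < g" "g \<le> L"
    and "(LINT t:{0..g}|lebesgue. t * Z \<nu> t) / (LINT t:{0..g}|lebesgue. Z \<nu> t) \<ge> (1 + \<epsilon>) * (g / 2)"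
  shows "moment 2 g \<le> (1 - \<epsilon>) * g * moment 1 g"
proof -
  have "(1 + \<epsilon>) * (g / 2) \<le> (g * moment 1 g - moment 2 g / 2) / moment 1 g"
    using assms(1,2) Z_pos[OF L]
    by (intro order_trans[OF assms(3)]) (simp add: integral_Z integral_id_Z)
  then show ?thesis
    using moment_1_pos[OF assms(1,2)] by (simp add: field_simps)
qed

end

section \<open>The potential of a gap\<close>

text \<open>Concavity of the power, obtained from Young's inequality with weights \<open>a\<close>
  and \<open>1 - a\<close>.\<close>

lemma powr_le_tangent_at_1:
  fixes y a :: real
  assumes "0 \<le> y" "0 < a" "a < 1"
  shows "y powr a \<le> 1 + a * (y - 1)"
proof (cases "y = 0")
  case False
  then show ?thesis
    using Youngs_inequality_0[of a "1 - a" y 1] assms by (simp add: algebra_simps)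
qed (use assms in simp)

text \<open>Both branches equal \<open>M\<close> at \<open>t = M\<close>. Short gaps are charged
  their full length; the charge of long gaps is sublinear when \<open>\<alpha> < 1\<close>.\<close>

definition potential :: "real \<Rightarrow> real \<Rightarrow> real \<Rightarrow> real" where
  "potential M \<alpha> t = (if t \<le> M then t else M * (t / M) powr \<alpha>)"

lemma potential_nonneg: "0 < M \<Longrightarrow> 0 \<le> t \<Longrightarrow> 0 \<le> potential M \<alpha> t"
  by (simp add: potential_def)

lemma potential_eq_powr: "0 < M \<Longrightarrow> M \<le> t \<Longrightarrow> potential M \<alpha> t = M * (t / M) powr \<alpha>"
  by (auto simp: potential_def)

text \<open>The power dominates both branches, so the parts of a split gap can be bounded without
  asking whether they exceed \<open>M\<close>.\<close>

lemma potential_le_powr: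
  assumes "0 < M" "0 \<le> t" "\<alpha> \<le> 1"
  shows "potential M \<alpha> t \<le> M * (t / M) powr \<alpha>"
proof (cases "t \<le> M")
  case True
  then have "t / M \<le> (t / M) powr \<alpha>"
    using powr_mono'[of \<alpha> 1 "t / M"] assms by simp
  then show ?thesis
    using True assms by (simp add: potential_def field_simps)
qed (simp add: potential_def)

lemma potential_le_self:
  assumes "0 < M" "\<alpha> \<le> 1"
  shows "potential M \<alpha> t \<le> t"
proof (cases "t \<le> M")
  case False
  then have "(t / M) powr \<alpha> \<le> t / M"
    using powr_mono[of \<alpha> 1 "t / M"] assms by simp
  then show ?thesis
    using False assms by (simp add: potential_def field_simps)
qed (simp add: potential_def)

text \<open>By \<open>2 * q powr \<alpha> = 1\<close>, the power branch at \<open>q * g\<close> is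
  half of \<open>potential M \<alpha> g\<close>. The tangent there bounds the charge of each part,
  and the two bounds add up.\<close>

lemma potential_split:
  assumes "0 < M" "M \<le> g" "0 \<le> u" "0 \<le> v" "0 < \<alpha>" "\<alpha> < 1" "0 < q" "2 * q powr \<alpha> = 1"
  shows "potential M \<alpha> u + potential M \<alpha> v - potential M \<alpha> g \<le>
    potential M \<alpha> g * \<alpha> * ((u + v) / (2 * q * g) - 1)"
proof -
  have *: "potential M \<alpha> x \<le> potential M \<alpha> g / 2 * (1 + \<alpha> * (x / (q * g) - 1))" if "0 \<le> x" for x
  proof -
    have "potential M \<alpha> x \<le> M * (x / M) powr \<alpha>"
      using that assms by (intro potential_le_powr) auto
    also have "x / M = g / M * q * (x / (q * g))"
      using assms by (simp add: field_simps)
    also have "M * \<dots> powr \<alpha> = potential M \<alpha> g * q powr \<alpha> * (x / (q * g)) powr \<alpha>"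
      using assms that by (simp add: potential_eq_powr powr_mult powr_divide)
    also have "q powr \<alpha> = 1 / 2"
      using assms by simp
    also have "potential M \<alpha> g * (1 / 2) * (x / (q * g)) powr \<alpha> \<le>
        potential M \<alpha> g * (1 / 2) * (1 + \<alpha> * (x / (q * g) - 1))"
      using assms that by (intro mult_left_mono powr_le_tangent_at_1) (auto simp: potential_nonneg)
    finally show ?thesis by simp
  qed
  have "potential M \<alpha> g / 2 * (1 + \<alpha> * (u / (q * g) - 1)) +
      potential M \<alpha> g / 2 * (1 + \<alpha> * (v / (q * g) - 1)) =
      potential M \<alpha> g + potential M \<alpha> g * \<alpha> * ((u + v) / (2 * q * g) - 1)"
    using assms by (simp add: field_simps)
  then show ?thesis
    using *[OF assms(3)] *[OF assms(4)] by linarith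
qed

section \<open>Expected empty space\<close>

context RSA
begin

abbreviation Step :: "(real \<times> real) measure" where "Step \<equiv> U \<Otimes>\<^sub>M \<Lambda>"

sublocale Step: pair_prob_space U \<Lambda> ..

sublocale Seq: sequence_space Step ..

lemma RSA_space_eq: "RSA_space \<nu> L = (\<Pi>\<^sub>M T\<in>(UNIV::nat set). Step)"
  by (simp add: RSA_space_def)

lemma sets_Step [measurable_cong]: "sets Step = sets (borel \<Otimes>\<^sub>M borel)"
  by (intro sets_pair_measure_cong) auto

text \<open>Endpoints and samples are arbitrary measurable functions because the recursion makes the
  endpoints random.\<close>

lemma measurable_RSA_total [measurable]:
  assumes "f \<in> borel_measurable X" "g \<in> borel_measurable X" "h \<in> X \<rightarrow>\<^sub>M Seq.S"
  shows "(\<lambda>x. RSA_total N (f x) (g x) (h x)) \<in> borel_measurable X"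
  using assms
proof (induction N arbitrary: f g h)
  case (Suc N)
  note [measurable] = Suc.prems
  have [measurable]: "(\<lambda>x. h x 0) \<in> X \<rightarrow>\<^sub>M borel \<Otimes>\<^sub>M borel"
    using measurable_compose[OF Suc.prems(3) measurable_component_singleton[of 0 UNIV "\<lambda>_. Step"]]
    by (simp add: measurable_cong_sets[OF refl sets_Step])
  have [measurable]: "(\<lambda>x i. h x (Suc i)) \<in> X \<rightarrow>\<^sub>M Seq.S"
    by (rule measurable_PiM_single') (auto simp: space_PiM space_pair_measure)
  note [measurable] = Suc.IH
  show ?case
    unfolding RSA_total.simps RSA_fits_def by measurable
qed simp

definition expected_total :: "nat \<Rightarrow> real \<Rightarrow> real \<Rightarrow> ennreal" where
  "expected_total N a b = (\<integral>\<^sup>+\<omega>. ennreal (RSA_total N a b \<omega>) \<partial>RSA_space \<nu> L)"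

text \<open>The later samples are independent of the first and have the same joint law as the whole
  sequence. The two new gaps share them, but linearity separates their expectations.\<close>

lemma expected_total_Suc:
  assumes "a \<le> b"
  shows "expected_total (Suc N) a b = ennreal (b - a) +
    (\<integral>\<^sup>+s. (if RSA_fits a b s
      then expected_total N a (fst s) + expected_total N (fst s + snd s) b
      else expected_total N a b) \<partial>Step)"
proof -
  have [measurable]: "Measurable.pred (Step \<Otimes>\<^sub>M Seq.S) (\<lambda>x. RSA_fits a b (fst x))"
    "Measurable.pred Step (RSA_fits a b)"
    unfolding RSA_fits_def by measurable
  have "expected_total (Suc N) a b =
      (\<integral>\<^sup>+\<omega>. ennreal (RSA_total (Suc N) a b \<omega>) \<partial>distr (Step \<Otimes>\<^sub>M Seq.S) Seq.S (\<lambda>(s, \<omega>). case_nat s \<omega>))"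
    by (simp only: expected_total_def RSA_space_eq Seq.PiM_iter)
  also have "\<dots> = (\<integral>\<^sup>+x. ennreal (RSA_total (Suc N) a b (case x of (s, \<omega>) \<Rightarrow> case_nat s \<omega>)) \<partial>(Step \<Otimes>\<^sub>M Seq.S))"
    by (rule nn_integral_distr) measurable
  also have "\<dots> = (\<integral>\<^sup>+s. \<integral>\<^sup>+\<omega>. ennreal (RSA_total (Suc N) a b (case (s, \<omega>) of (s, \<omega>) \<Rightarrow> case_nat s \<omega>)) \<partial>Seq.S \<partial>Step)"
    by (rule Seq.P.nn_integral_fst[symmetric]) measurable
  also have "\<dots> = (\<integral>\<^sup>+s. ennreal (b - a) + (if RSA_fits a b s
      then expected_total N a (fst s) + expected_total N (fst s + snd s) b
      else expected_total N a b) \<partial>Step)"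
  proof (rule nn_integral_cong)
    fix s
    show "(\<integral>\<^sup>+\<omega>. ennreal (RSA_total (Suc N) a b (case (s, \<omega>) of (s, \<omega>) \<Rightarrow> case_nat s \<omega>)) \<partial>Seq.S) =
      ennreal (b - a) + (if RSA_fits a b s
        then expected_total N a (fst s) + expected_total N (fst s + snd s) b
        else expected_total N a b)"
    proof (cases "RSA_fits a b s")
      case True
      then have "a \<le> fst s" "fst s + snd s \<le> b"
        by (auto simp: RSA_fits_def)
      with True show ?thesis
        using assms
        by (simp add: expected_total_def RSA_space_eq RSA_total_nonneg nn_integral_add Seq.P.emeasure_space_1)
    qed (use assms in \<open>simp add: expected_total_def RSA_space_eq RSA_total_nonneg nn_integral_add
        Seq.P.emeasure_space_1\<close>)
  qed
  also have "\<dots> = ennreal (b - a) + (\<integral>\<^sup>+s. (if RSA_fits a b s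
      then expected_total N a (fst s) + expected_total N (fst s + snd s) b
      else expected_total N a b) \<partial>Step)"
    unfolding expected_total_def RSA_space_eq
    by (subst nn_integral_add) (measurable, simp add: Step.emeasure_space_1)
  finally show ?thesis .
qed

text \<open>Given the length \<open>l\<close>, the admissible starting points form an interval of
  length \<open>max 0 (b - a - l)\<close>, which raises the exponent by one. For
  \<open>k = 0\<close>, \<open>F\<close> is the indicator of fitting.\<close>

lemma integral_fits:
  fixes k :: nat
  assumes "0 \<le> a" "a \<le> b" "b \<le> L"
  defines "F \<equiv> (\<lambda>s. if RSA_fits a b s then (max 0 (b - a - snd s)) ^ k else 0)"
  shows "integrable Step F" "(\<integral>s. F s \<partial>Step) = moment (Suc k) (b - a) / L"
proof -
  have [measurable]: "F \<in> borel_measurable Step"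
    unfolding F_def RSA_fits_def by measurable
  show int: "integrable Step F"
  proof (rule Step.integrable_const_bound)
    show "AE s in Step. norm (F s) \<le> (b - a) ^ k"
      using assms(2) by (auto simp: F_def RSA_fits_def intro!: AE_I2 power_mono)
  qed measurable
  have "(\<integral>s. F s \<partial>Step) = (\<integral>l. (\<integral>u. F (u, l) \<partial>U) \<partial>\<Lambda>)"
    using Step.integral_snd[of "\<lambda>u l. F (u, l)"] int by simp
  also have "\<dots> = (\<integral>l. (max 0 (b - a - l)) ^ Suc k / L \<partial>\<Lambda>)"
  proof (rule integral_cong_AE)
    show "AE l in \<Lambda>. (\<integral>u. F (u, l) \<partial>U) = (max 0 (b - a - l)) ^ Suc k / L"
      using AE_length_law
    proof eventually_elim
      case (elim l)
      have "(\<integral>u. F (u, l) \<partial>U) = (\<integral>u. (max 0 (b - a - l)) ^ k * indicator {a..b - l} u \<partial>U)"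
        using elim by (intro Bochner_Integration.integral_cong)
          (auto simp: F_def RSA_fits_def split: split_indicator)
      also have "\<dots> = (max 0 (b - a - l)) ^ k * measure U {a..b - l}"
        by simp
      also have "measure U {a..b - l} = max 0 (b - a - l) / L"
      proof -
        have "measure U {a..b - l} = measure lborel ({0..L} \<inter> {a..b - l}) / measure lborel {0..L}"
          by (rule measure_uniform_measure) (use L in auto)
        also have "{0..L} \<inter> {a..b - l} = {a..b - l}"
          using elim assms by auto
        also have "measure lborel {a..b - l} / measure lborel {0..L} = max 0 (b - a - l) / L"
          using L by (simp add: max_def)
        finally show ?thesis .
      qed
      finally show ?case by simp
    qed
  qed measurable
  also have "\<dots> = moment (Suc k) (b - a) / L"
    by (simp add: moment_def)
  finally show "(\<integral>s. F s \<partial>Step) = moment (Suc k) (b - a) / L" .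
qed

text \<open>
  A segment fits into a given gap of length \<open>M\<close> with probability \<open>p = moment 1 M / L\<close>, so \<open>C = L / p\<close>. A gap
  longer than \<open>M\<close> loses expected length at least \<open>p\<close> per step, which releases at least \<open>L\<close> from the term
  \<open>(b - a) * C\<close>: enough to pay for the empty space of that gap at that step.
\<close>

lemma expected_total_le:
  assumes q: "0 < q" "0 < \<alpha>" "\<alpha> < 1" "2 * q powr \<alpha> = 1"
    and M: "1 < M" "M \<le> L"
    and mom: "\<And>g. M \<le> g \<Longrightarrow> g \<le> L \<Longrightarrow> moment 2 g \<le> 2 * q * g * moment 1 g"
    and ab: "0 \<le> a" "a \<le> b" "b \<le> L"
  defines "C \<equiv> L\<^sup>2 / moment 1 M"
  shows "expected_total N a b \<le> ennreal (N * potential M \<alpha> (b - a) + (b - a) * C)"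
  using ab
proof (induction N arbitrary: a b)
  case 0
  then show ?case by (simp add: expected_total_def)
next
  case (Suc N)
  define \<phi> where "\<phi> = potential M \<alpha>"
  define h where "h x = N * \<phi> x + x * C" for x
  define g where "g = b - a"
  have IH: "expected_total N x y \<le> ennreal (h (y - x))" if "0 \<le> x" "x \<le> y" "y \<le> L" for x y
    using Suc.IH[OF that] by (simp add: h_def \<phi>_def)
  have \<phi>_nonneg: "0 \<le> \<phi> x" if "0 \<le> x" for x
    using that M by (simp add: \<phi>_def potential_nonneg)
  have C: "0 < C"
    using M L moment_1_pos[of M] by (simp add: C_def)
  have h_nonneg: "0 \<le> h x" if "0 \<le> x" for x
    using that C \<phi>_nonneg[OF that] by (simp add: h_def)
  have g: "0 \<le> g" "g \<le> L" using Suc.prems by (auto simp: g_def)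
  define f where "f s = (if RSA_fits a b s then h (fst s - a) + h (b - (fst s + snd s)) else h g)" for s
  define I where "I = (\<integral>\<^sup>+s. (if RSA_fits a b s
      then expected_total N a (fst s) + expected_total N (fst s + snd s) b
      else expected_total N a b) \<partial>Step)"
  have f_nonneg: "0 \<le> f s" for s
    using g by (auto simp: f_def RSA_fits_def intro!: h_nonneg add_nonneg_nonneg)
  have I_le: "I \<le> (\<integral>\<^sup>+s. ennreal (f s) \<partial>Step)"
    unfolding I_def
  proof (rule nn_integral_mono)
    fix s
    show "(if RSA_fits a b s then expected_total N a (fst s) + expected_total N (fst s + snd s) b
        else expected_total N a b) \<le> ennreal (f s)"
    proof (cases "RSA_fits a b s")
      case True
      then have s: "0 \<le> fst s - a" "0 \<le> b - (fst s + snd s)" "0 < snd s"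
        by (auto simp: RSA_fits_def)
      have "expected_total N a (fst s) + expected_total N (fst s + snd s) b \<le>
          ennreal (h (fst s - a)) + ennreal (h (b - (fst s + snd s)))"
        using s Suc.prems by (intro add_mono IH) auto
      also have "\<dots> = ennreal (f s)"
        using True s h_nonneg by (simp add: f_def)
      finally show ?thesis using True by simp
    qed (use IH[of a b] Suc.prems in \<open>simp add: f_def g_def\<close>)
  qed
  \<comment> \<open>This is the induction step: \<open>h g + \<phi> g\<close> is the claimed bound
    for \<open>Suc N\<close>.\<close>
  have "I + ennreal g \<le> ennreal (h g + \<phi> g)"
  proof (cases "g < M")
    case True
    \<comment> \<open>For a short gap \<open>\<phi> g = g\<close> pays for the current step, so it
      suffices that splitting does not increase \<open>h\<close>.\<close>
    have "f s \<le> h g" if "s \<in> space Step" for s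
    proof (cases "RSA_fits a b s")
      case fits: True
      then have s: "0 \<le> fst s - a" "0 \<le> b - (fst s + snd s)" "0 < snd s"
        by (auto simp: RSA_fits_def)
      have "\<phi> (fst s - a) + \<phi> (b - (fst s + snd s)) \<le> \<phi> g"
        using potential_le_self[of M \<alpha> "fst s - a"] potential_le_self[of M \<alpha> "b - (fst s + snd s)"]
          s True M q by (simp add: \<phi>_def potential_def[of M \<alpha> g]) (simp add: g_def)
      then have "N * (\<phi> (fst s - a) + \<phi> (b - (fst s + snd s))) \<le> N * \<phi> g"
        by (intro mult_left_mono) auto
      moreover have "(fst s - a) * C + (b - (fst s + snd s)) * C \<le> g * C"
        using s C by (simp add: g_def flip: distrib_right)
      ultimately show ?thesis
        using fits by (simp add: f_def h_def distrib_left)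
    qed (simp add: f_def)
    then have "(\<integral>\<^sup>+s. ennreal (f s) \<partial>Step) \<le> (\<integral>\<^sup>+s. ennreal (h g) \<partial>Step)"
      by (intro nn_integral_mono ennreal_leI)
    then have "I \<le> ennreal (h g)"
      using I_le by (simp add: Step.emeasure_space_1)
    moreover have "\<phi> g = g"
      using True by (simp add: \<phi>_def potential_def)
    ultimately show ?thesis
      using g h_nonneg[of g] by (simp add: add_right_mono)
  next
    case False
    define k where "k = N * (\<phi> g * \<alpha>)"
    define F where "F j s = (if RSA_fits a b s then (max 0 (b - a - snd s)) ^ j else 0)" for j :: nat and s
    \<comment> \<open>When the segment fits, \<open>N\<close> times the bound of
      \<open>potential_split\<close> gives the terms in \<open>k\<close>, and the loss of length at
      least 1 gives \<open>- C\<close>. \<open>F 0\<close> and \<open>F 1\<close> express this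
      through moments.\<close>
    define W where "W s = h g + (k / (2 * q * g) * F 1 s - (k + C) * F 0 s)" for s
    note F = integral_fits[OF Suc.prems, folded F_def]
    have k: "0 \<le> k" using q \<phi>_nonneg[OF g(1)] by (simp add: k_def)
    have AE_len: "AE s in Step. 1 \<le> snd s"
    proof -
      have [measurable]: "Measurable.pred Step (\<lambda>s. 1 \<le> snd s \<and> snd s \<le> L)"
        by measurable
      have "AE s in Step. 1 \<le> snd s \<and> snd s \<le> L"
        by (rule Step.AE_pair_measure) (measurable, use AE_length_law in simp)
      then show ?thesis by eventually_elim simp
    qed
    have f_le: "AE s in Step. f s \<le> W s"
      using AE_len
    proof eventually_elim
      case (elim s)
      show ?case
      proof (cases "RSA_fits a b s")
        case fits: True
        then have s: "0 \<le> fst s - a" "0 \<le> b - (fst s + snd s)"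
          by (auto simp: RSA_fits_def)
        have sum: "fst s - a + (b - (fst s + snd s)) = g - snd s"
          by (simp add: g_def)
        have "\<phi> (fst s - a) + \<phi> (b - (fst s + snd s)) - \<phi> g \<le>
            \<phi> g * \<alpha> * ((fst s - a + (b - (fst s + snd s))) / (2 * q * g) - 1)"
          unfolding \<phi>_def using s False M q by (intro potential_split) auto
        then have "N * (\<phi> (fst s - a) + \<phi> (b - (fst s + snd s)) - \<phi> g) \<le>
            N * (\<phi> g * \<alpha> * ((g - snd s) / (2 * q * g) - 1))"
          unfolding sum by (intro mult_left_mono) auto
        also have "\<dots> = k / (2 * q * g) * (g - snd s) - k"
          by (simp add: k_def algebra_simps)
        finally have 1: "N * (\<phi> (fst s - a) + \<phi> (b - (fst s + snd s)) - \<phi> g) \<le>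
            k / (2 * q * g) * (g - snd s) - k" .
        have "(fst s - a) * C + (b - (fst s + snd s)) * C = (g - snd s) * C"
          by (simp add: sum flip: distrib_right)
        moreover have "1 * C \<le> snd s * C"
          using elim C by (intro mult_right_mono) auto
        ultimately have 2: "(fst s - a) * C + (b - (fst s + snd s)) * C \<le> g * C - C"
          by (simp add: left_diff_distrib)
        have "F 1 s = g - snd s" "F 0 s = 1"
          using fits s by (auto simp: F_def g_def)
        then have "W s = N * \<phi> g + g * C + (k / (2 * q * g) * (g - snd s) - k - C)"
          by (simp add: W_def h_def)
        moreover have "f s = N * (\<phi> (fst s - a) + \<phi> (b - (fst s + snd s)) - \<phi> g) + N * \<phi> g +
            ((fst s - a) * C + (b - (fst s + snd s)) * C)"
          using fits by (simp add: f_def h_def algebra_simps)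
        ultimately show ?thesis
          using 1 2 by linarith
      qed (simp add: f_def W_def F_def)
    qed
    have int_W: "integrable Step W"
      unfolding W_def using F(1)[of 0] F(1)[of 1]
      by (intro Bochner_Integration.integrable_add Bochner_Integration.integrable_diff
          integrable_mult_right) auto
    define w where "w = (\<integral>s. W s \<partial>Step)"
    have W_nonneg: "AE s in Step. 0 \<le> W s"
      using f_le by eventually_elim (use f_nonneg order_trans in blast)
    then have w_nonneg: "0 \<le> w"
      unfolding w_def by (rule integral_nonneg_AE)
    have "I \<le> (\<integral>\<^sup>+s. ennreal (W s) \<partial>Step)"
      using f_le by (intro order_trans[OF I_le] nn_integral_mono_AE) (auto intro: ennreal_leI)
    also have "\<dots> = ennreal w"
      unfolding w_def using W_nonneg by (intro nn_integral_eq_integral int_W)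
    finally have I_w: "I \<le> ennreal w" .
    have "w = h g + (k / (2 * q * g) * (moment 2 g / L) - (k + C) * (moment 1 g / L))"
      unfolding w_def W_def using F[of 0] F[of 1]
      by (simp add: Step.prob_space g_def numeral_2_eq_2)
    also have "\<dots> \<le> h g - L"
    proof -
      \<comment> \<open>The moment hypothesis enters here: the terms in \<open>k\<close> have
        nonpositive expectation.\<close>
      have "k / (2 * q * g) * moment 2 g \<le> k / (2 * q * g) * (2 * q * g * moment 1 g)"
        using mom[of g] False g q k M by (intro mult_left_mono) auto
      also have "\<dots> = k * moment 1 g"
        using False q M by simp
      finally have "k / (2 * q * g) * (moment 2 g / L) \<le> k * (moment 1 g / L)"
        using L by (simp add: field_simps)
      moreover have "L \<le> C * (moment 1 g / L)"
      proof -
        have "L * 1 \<le> L * (moment 1 g / moment 1 M)"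
          using moment_mono[of M g 1] False moment_1_pos[of M] M L by (intro mult_left_mono) auto
        also have "\<dots> = C * (moment 1 g / L)"
          using L by (simp add: C_def power2_eq_square)
        finally show ?thesis by simp
      qed
      ultimately show ?thesis
        unfolding distrib_right by linarith
    qed
    finally have "w \<le> h g - L" .
    then have "I + ennreal g \<le> ennreal (w + g)"
      using I_w w_nonneg g by (simp add: add_right_mono)
    also have "\<dots> \<le> ennreal (h g + \<phi> g)"
      using \<open>w \<le> h g - L\<close> g \<phi>_nonneg[of g] by (intro ennreal_leI) linarith
    finally show ?thesis .
  qed
  then show ?case
    unfolding expected_total_Suc[OF Suc.prems(2)] I_def[symmetric]
    by (simp add: h_def g_def \<phi>_def algebra_simps)
qed

section \<open>Letting first the number of steps, then \<open>L\<close>, tend to infinity\<close>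

lemma expected_empty_space_nonneg: "0 \<le> expected_empty_space \<nu> L"
  using L RSA_empty_space_le_total(1)[of L] by (auto simp: expected_empty_space_def intro!: integral_nonneg)

text \<open>\<open>N\<close> times the excess of the expectation over the potential is at most
  \<open>L * C\<close>, which does not depend on \<open>N\<close>; hence the excess is not
  positive.\<close>

lemma expected_empty_space_le_potential:
  assumes q: "0 < q" "0 < \<alpha>" "\<alpha> < 1" "2 * q powr \<alpha> = 1"
    and M: "1 < M" "M \<le> L"
    and mom: "\<And>g. M \<le> g \<Longrightarrow> g \<le> L \<Longrightarrow> moment 2 g \<le> 2 * q * g * moment 1 g"
  shows "expected_empty_space \<nu> L \<le> potential M \<alpha> L"
proof (cases "integrable (RSA_space \<nu> L) (RSA_empty_space L)")
  case True
  define E where "E = expected_empty_space \<nu> L"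
  define C where "C = L\<^sup>2 / moment 1 M"
  have S: "0 \<le> RSA_empty_space L \<omega>" for \<omega>
    using L RSA_empty_space_le_total(1)[of L] by simp
  have E: "E = (\<integral>\<omega>. RSA_empty_space L \<omega> \<partial>RSA_space \<nu> L)"
    using L by (simp add: E_def expected_empty_space_def)
  have "real N * (E - potential M \<alpha> L) \<le> L * C" for N
  proof -
    have "ennreal (real N * E) = (\<integral>\<^sup>+\<omega>. ennreal (real N * RSA_empty_space L \<omega>) \<partial>RSA_space \<nu> L)"
      unfolding E using True S by (subst nn_integral_eq_integral) auto
    also have "\<dots> \<le> expected_total N 0 L"
      unfolding expected_total_def
      using L RSA_empty_space_le_total(2)[of L] by (intro nn_integral_mono ennreal_leI) auto
    also have "\<dots> \<le> ennreal (N * potential M \<alpha> (L - 0) + (L - 0) * C)"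
      unfolding C_def using L by (intro expected_total_le[OF q M mom]) auto
    finally have "real N * E \<le> N * potential M \<alpha> L + L * C"
      using L M moment_1_pos[of M] by (subst (asm) ennreal_le_iff) (auto simp: C_def potential_nonneg)
    then show ?thesis by (simp add: right_diff_distrib)
  qed
  then have "\<not> 0 < E - potential M \<alpha> L"
    using reals_Archimedean3[of "E - potential M \<alpha> L"] by (metis not_le)
  then show ?thesis by (simp add: E_def)
next
  \<comment> \<open>The Bochner integral of a non-integrable function is 0 by convention, so the
    bound holds here too.\<close>
  case False
  then show ?thesis
    using L M by (simp add: expected_empty_space_def not_integrable_integral_eq potential_nonneg)
qed

end

lemma potential_sublinear:
  assumes "0 < M" "\<alpha> < 1"
  shows "((\<lambda>t. potential M \<alpha> t / t) \<longlongrightarrow> 0) at_top"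
proof (rule Lim_transform_eventually)
  have "filterlim (\<lambda>t. inverse M * t) at_top at_top"
    using assms by (intro filterlim_tendsto_pos_mult_at_top[OF tendsto_const] filterlim_ident) auto
  then have "filterlim (\<lambda>t. t / M) at_top at_top"
    by (simp add: field_simps)
  then show "((\<lambda>t. (t / M) powr (\<alpha> - 1)) \<longlongrightarrow> 0) at_top"
    using assms by (intro tendsto_neg_powr) auto
  show "\<forall>\<^sub>F t in at_top. (t / M) powr (\<alpha> - 1) = potential M \<alpha> t / t"
    using eventually_ge_at_top[of M]
    by eventually_elim (use assms in \<open>simp add: potential_eq_powr powr_diff field_simps\<close>)
qed

theorem theorem5p5:
  fixes \<nu> :: "real \<Rightarrow> real"
  assumes "divergent_ldf \<nu>"
    and "\<exists>\<epsilon>>0. \<forall>\<^sub>F L in at_top.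
           (LINT t:{0..L}|lebesgue. t * Z \<nu> t) / (LINT t:{0..L}|lebesgue. Z \<nu> t)
             \<ge> (1 + \<epsilon>) * (L / 2)"
  shows "((\<lambda>L. expected_empty_space \<nu> L / L) \<longlongrightarrow> 0) at_top"
proof -
  have ldf: "ldf \<nu>" using assms(1) by (simp add: divergent_ldf_def)
  obtain \<epsilon> M0 where \<epsilon>: "0 < \<epsilon>" and M0: "\<And>g. M0 \<le> g \<Longrightarrow>
      (LINT t:{0..g}|lebesgue. t * Z \<nu> t) / (LINT t:{0..g}|lebesgue. Z \<nu> t) \<ge> (1 + \<epsilon>) * (g / 2)"
    using assms(2) unfolding eventually_at_top_linorder by blast
  \<comment> \<open>\<open>M\<close> exceeds 1, so \<open>moment 1 M\<close> is positive, and it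
    does not depend on \<open>L\<close>: one potential serves all \<open>L >= M\<close>.\<close>
  define M where "M = max 2 M0"
  \<comment> \<open>Capping \<epsilon> at 1/2 keeps \<open>q\<close> positive;
    \<open>q < 1 / 2\<close> makes the solution \<alpha> of \<open>2 * q powr \<alpha> = 1\<close>
    smaller than 1.\<close>
  define q where "q = (1 - min \<epsilon> (1 / 2)) / 2"
  define \<alpha> where "\<alpha> = ln 2 / ln (1 / q)"
  have q: "0 < q" "q < 1 / 2" "1 - \<epsilon> \<le> 2 * q"
    using \<epsilon> by (auto simp: q_def min_def)
  have "ln 2 < ln (1 / q)"
    using q by (subst ln_less_cancel_iff) (auto simp: field_simps)
  moreover have "0 < ln (2 :: real)"
    by simp
  ultimately have \<alpha>: "0 < \<alpha>" "\<alpha> < 1"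
    by (auto simp: \<alpha>_def simp del: ln_gt_zero_iff)
  have "\<alpha> * ln q = - ln 2"
    using \<open>ln 2 < ln (1 / q)\<close> q by (simp add: \<alpha>_def ln_div)
  then have "2 * q powr \<alpha> = 1"
    using q by (simp add: powr_def exp_minus)
  have bound: "norm (expected_empty_space \<nu> L / L) \<le> potential M \<alpha> L / L" if "M \<le> L" for L
  proof -
    interpret RSA \<nu> L
      using ldf that by unfold_locales (auto simp: M_def)
    have "moment 2 g \<le> 2 * q * g * moment 1 g" if "M \<le> g" "g \<le> L" for g
    proof -
      have g: "1 < g" "M0 \<le> g" using that by (auto simp: M_def)
      have "moment 2 g \<le> (1 - \<epsilon>) * g * moment 1 g"
        using g that M0 by (intro moment_2_le) auto
      also have "\<dots> \<le> 2 * q * g * moment 1 g"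
        using g that moment_1_pos[of g] q by (intro mult_right_mono) auto
      finally show ?thesis .
    qed
    then have "expected_empty_space \<nu> L \<le> potential M \<alpha> L"
      using q \<alpha> \<open>2 * q powr \<alpha> = 1\<close> that
      by (intro expected_empty_space_le_potential[where q = q]) (auto simp: M_def)
    then show ?thesis
      using expected_empty_space_nonneg L by (simp add: divide_right_mono)
  qed
  show ?thesis
  proof (rule Lim_null_comparison)
    show "((\<lambda>L. potential M \<alpha> L / L) \<longlongrightarrow> 0) at_top"
      using \<alpha> by (intro potential_sublinear) (auto simp: M_def)
    show "\<forall>\<^sub>F L in at_top. norm (expected_empty_space \<nu> L / L) \<le> potential M \<alpha> L / L"
      using eventually_ge_at_top[of M] by eventually_elim (rule bound)
  qed
qed

end
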